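(* For any integer $n\geq 2$, the $n$-step nilpotent Lie algebra $T^*\mathfrak g$, where $\mathfrak g=\mathbb R\ltimes_{J_n(0)}\mathbb R^n$, admits uncountably many symplectic structures which are pairwise non-symplectomorphic up to homothety.
   Context: Lie algebras are real and finite-dimensional. A symplectic structure on a Lie algebra $\mathfrak h$ is a non-degenerate skew-symmetric bilinear form $\omega$ on $\mathfrak h$ with $\omega(x,[y,z])+\omega(y,[z,x])+\omega(z,[x,y])=0$ for all $x,y,z\in\mathfrak h$. Two symplectic structures $\omega,\omega'$ on $\mathfrak h$ are symplectomorphic up to homothety if there exist a Lie algebra automorphism $\phi$ of $\mathfrak h$ and a real $c\ne0$ with $\phi^*\omega'=c\,\omega$. For an integer $n\ge2$, $\mathfrak g=\mathbb R\ltimes_{J_n(0)}\mathbb R^n$ is the $(n+1)$-dimensional Lie algebra with basis $t,e_1,\dots,e_n$ whose only nonzero brackets (up to antisymmetry) are $[t,e_{i+1}]=e_i$, $i=1,\dots,n-1$. The cotangent Lie algebra $T^*\mathfrak g=\mathfrak g\oplus\mathfrak g^*$ has bracket $[x+\phi,y+\psi]=[x,y]_{\mathfrak g}+\mathrm{ad}^*_x\psi-\mathrm{ad}^*_y\phi$, where $\mathrm{ad}^*_x\phi=-\phi\circ\mathrm{ad}_x$. Let $z,e^1,\dots,e^n$ be the basis of $\mathfrak g^*$ dual to $t,e_1,\dots,e_n$ and put $f_i=e^{n-i+1}$. Then $T^*\mathfrak g$ has basis $z,e_1,f_1,\dots,e_n,f_n,t$, and its nonzero brackets (up to antisymmetry)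 are, for $i=1,\dots,n-1$: $[t,e_{i+1}]=e_i$, $[t,f_{i+1}]=-f_i$, $[e_{i+1},f_{n-i+1}]=z$. *)

theory Defs
  imports "HOL-Analysis.Analysis"
begin

text \<open>
  A real Lie algebra is given by a bracket on a type of class
  \<^class>\<open>real_vector\<close>; the underlying vector space is the whole type.
\<close>

definition lie_algebra :: "('a::real_vector \<Rightarrow> 'a \<Rightarrow> 'a) \<Rightarrow> bool" where
  "lie_algebra br \<longleftrightarrow>
     bilinear br \<and> (\<forall>x. br x x = 0) \<and>
     (\<forall>x y z. br x (br y z) + br y (br z x) + br z (br x y) = 0)"

definition lie_automorphism :: "('a::real_vector \<Rightarrow> 'a \<Rightarrow> 'a) \<Rightarrow> ('a \<Rightarrow> 'a) \<Rightarrow> bool" where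
  "lie_automorphism br \<phi> \<longleftrightarrow>
     linear \<phi> \<and> bij \<phi> \<and> (\<forall>x y. \<phi> (br x y) = br (\<phi> x) (\<phi> y))"

fun lower_central_series :: "('a::real_vector \<Rightarrow> 'a \<Rightarrow> 'a) \<Rightarrow> nat \<Rightarrow> 'a set" where
  "lower_central_series br 0 = UNIV"
| "lower_central_series br (Suc k) = span {br x y | x y. y \<in> lower_central_series br k}"

definition nilpotent_of_step :: "('a::real_vector \<Rightarrow> 'a \<Rightarrow> 'a) \<Rightarrow> nat \<Rightarrow> bool" where
  "nilpotent_of_step br k \<longleftrightarrow>
     lower_central_series br k = {0} \<and> (\<forall>j<k. lower_central_series br j \<noteq> {0})"

definition symplectic_structure ::
    "('a::real_vector \<Rightarrow> 'a \<Rightarrow> 'a) \<Rightarrow> ('a \<Rightarrow> 'a \<Rightarrow> real) \<Rightarrow> bool" where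
  "symplectic_structure br \<omega> \<longleftrightarrow>
     bilinear \<omega> \<and>
     (\<forall>x y. \<omega> x y = - \<omega> y x) \<and>
     (\<forall>x. (\<forall>y. \<omega> x y = 0) \<longrightarrow> x = 0) \<and>
     (\<forall>x y z. \<omega> x (br y z) + \<omega> y (br z x) + \<omega> z (br x y) = 0)"

definition symplectomorphic_up_to_homothety ::
    "('a::real_vector \<Rightarrow> 'a \<Rightarrow> 'a) \<Rightarrow> ('a \<Rightarrow> 'a \<Rightarrow> real) \<Rightarrow> ('a \<Rightarrow> 'a \<Rightarrow> real) \<Rightarrow> bool" where
  "symplectomorphic_up_to_homothety br \<omega> \<omega>' \<longleftrightarrow>
     (\<exists>\<phi> c. lie_automorphism br \<phi> \<and> c \<noteq> 0 \<and> (\<forall>x y. \<omega>' (\<phi> x) (\<phi> y) = c * \<omega> x y))"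

text \<open>
  The dual of a finite-dimensional space \<open>'a\<close> is the type \<open>'a \<Rightarrow>\<^sub>L real\<close>, since there
  every linear functional is bounded.  For the same reason \<^const>\<open>Blinfun\<close>
  applied to \<open>br x\<close> is the genuine operator \<open>ad x\<close> whenever \<open>br\<close> is bilinear.
\<close>

definition coad ::
    "('a::euclidean_space \<Rightarrow> 'a \<Rightarrow> 'a) \<Rightarrow> 'a \<Rightarrow> ('a \<Rightarrow>\<^sub>L real) \<Rightarrow> ('a \<Rightarrow>\<^sub>L real)" where
  "coad br x \<phi> = - (\<phi> o\<^sub>L Blinfun (br x))"

definition cotangent_bracket ::
    "('a::euclidean_space \<Rightarrow> 'a \<Rightarrow> 'a) \<Rightarrow>
     'a \<times> ('a \<Rightarrow>\<^sub>L real) \<Rightarrow> 'a \<times> ('a \<Rightarrow>\<^sub>L real) \<Rightarrow> 'a \<times> ('a \<Rightarrow>\<^sub>L real)" where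
  "cotangent_bracket br X Y =
     (br (fst X) (fst Y), coad br (fst X) (snd Y) - coad br (fst Y) (snd X))"

text \<open>
  The semidirect product of \<open>\<real>\<close> and \<open>\<real>\<^sup>n\<close> in which \<open>t = (1, 0)\<close> acts on \<open>\<real>\<^sup>n\<close> by \<open>A\<close>.
\<close>

definition semidirect_bracket ::
    "real ^ 'n ^ 'n \<Rightarrow> real \<times> (real ^ 'n) \<Rightarrow> real \<times> (real ^ 'n) \<Rightarrow> real \<times> (real ^ 'n)" where
  "semidirect_bracket A X Y = (0, fst X *\<^sub>R (A *v snd Y) - fst Y *\<^sub>R (A *v snd X))"

text \<open>
  The coordinates of \<open>\<real>\<^sup>n\<close> are indexed by a finite linearly ordered type, and
  \<open>position\<close> numbers them \<open>1, \<dots>, n\<close> increasingly.  The block is upper triangular: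
  \<open>jordan_block 0\<close> maps \<open>e\<^sub>i\<^sub>+\<^sub>1\<close> to \<open>e\<^sub>i\<close> and \<open>e\<^sub>1\<close> to \<open>0\<close>.
\<close>

definition position :: "'n::{finite,linorder} \<Rightarrow> nat" where
  "position i = card {..i}"

definition jordan_block :: "real \<Rightarrow> real ^ 'n::{finite,linorder} ^ 'n::{finite,linorder}" where
  "jordan_block a =
     (\<chi> i j. if i = j then a else if position j = Suc (position i) then 1 else 0)"

end

theory Submission
  imports Defs
begin

text \<open>
  Pairing the ad-invariant duality form with the diagonal derivation that has weight \<open>1\<close> on \<open>t\<close>,
  \<open>\<mu> + n - i\<close> on \<open>e\<^sub>i\<close>, \<open>-1\<close> on \<open>z\<close> and \<open>-(\<mu> + n - i)\<close> on \<open>e\<^sup>i\<close> gives a symplectic form \<open>\<omega>\<^sub>\<mu>\<close>.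
  The bilinear forms \<open>B\<^sub>x(y, w) = \<omega>\<^sub>\<mu>(w, (ad x)\<^bsup>n-1\<^esup> y)\<close> transform naturally under automorphisms.
  For \<open>x = t\<close> the ratio \<open>B\<^sub>t(f\<^sub>n, e\<^sub>n) / B\<^sub>t(e\<^sub>n, f\<^sub>n) = \<plusminus>\<mu> / (\<mu> + n - 1)\<close> is insensitive to homothety.
  If \<open>\<mu>, \<nu> > 1\<close> and an automorphism carrying \<open>\<omega>\<^sub>\<nu>\<close> to a multiple of \<open>\<omega>\<^sub>\<mu>\<close> maps \<open>t, e\<^sub>n, f\<^sub>n\<close> to
  \<open>x, y, w\<close>, then \<open>B\<^sub>x\<close> for \<open>\<omega>\<^sub>\<nu>\<close> has the same ratio on \<open>y, w\<close>, is isotropic on \<open>y\<close> and on \<open>w\<close>, and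
  satisfies \<open>B\<^sub>x(y, x) = B\<^sub>x(w, x) = 0\<close>, which forces \<open>\<mu> = \<nu>\<close>.
\<close>

section \<open>Positions and powers of the nilpotent Jordan block\<close>

lemma bij_betw_position:
  "bij_betw (position :: 'n::{finite,linorder} \<Rightarrow> nat) UNIV {1..CARD('n)}"
proof -
  have mono: "position i < position j" if "i < j" for i j :: 'n
  proof -
    have "{..i} \<subset> {..j}" using that by auto
    then show ?thesis unfolding position_def by (simp add: psubset_card_mono)
  qed
  have inj: "inj (position :: 'n \<Rightarrow> nat)"
    by (rule linorder_injI) (metis mono less_irrefl)
  have sub: "range (position :: 'n \<Rightarrow> nat) \<subseteq> {1..CARD('n)}"
  proof
    fix k assume "k \<in> range (position :: 'n \<Rightarrow> nat)"
    then obtain i :: 'n where k: "k = card {..i}" by (auto simp: position_def)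
    have "card {..i} > 0" by (subst card_gt_0_iff) auto
    moreover have "card {..i} \<le> CARD('n)" by (intro card_mono) auto
    ultimately show "k \<in> {1..CARD('n)}" using k by simp
  qed
  have "range (position :: 'n \<Rightarrow> nat) = {1..CARD('n)}"
    by (rule card_subset_eq) (use sub inj in \<open>auto simp: card_image\<close>)
  then show ?thesis using inj by (simp add: bij_betw_def)
qed

text \<open>Outside 1, ..., n the value is arbitrary, hence the guards on positions below.\<close>

definition at_position :: "nat \<Rightarrow> 'n::{finite,linorder}" where
  "at_position = inv position"

lemma at_position_position [simp]: "at_position (position i) = i"
  using inv_f_f[OF bij_betw_imp_inj_on[OF bij_betw_position]] by (simp add: at_position_def)

lemma position_at_position:
  "1 \<le> k \<Longrightarrow> k \<le> CARD('n) \<Longrightarrow> position (at_position k :: 'n::{finite,linorder}) = k"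
  using bij_betw_position[where 'n='n] unfolding at_position_def bij_betw_def
  by (intro f_inv_into_f) auto

lemma position_ge_1: "1 \<le> position i" and position_le_CARD: "position (i::'n) \<le> CARD('n)"
  for i :: "'n::{finite,linorder}"
  using bij_betw_apply[OF bij_betw_position, of i] by auto

lemma jordan_block_0_nth:
  fixes u :: "real ^ 'n::{finite,linorder}"
  shows "(jordan_block 0 *v u) $ i =
    (if position i < CARD('n) then u $ at_position (Suc (position i)) else 0)"
proof -
  have "(jordan_block 0 *v u) $ i =
      (\<Sum>j\<in>UNIV. if position j = Suc (position i) then u $ j else 0)"
    unfolding matrix_vector_mult_def jordan_block_def by (auto intro!: sum.cong)
  also have "\<dots> = (\<Sum>j\<in>UNIV. if j = at_position (Suc (position i)) \<and> position i < CARD('n)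
      then u $ j else 0)"
  proof (rule sum.cong)
    fix j :: 'n
    have "position j = Suc (position i) \<longleftrightarrow>
        j = at_position (Suc (position i)) \<and> position i < CARD('n)"
      using position_le_CARD[of j] position_at_position[of "Suc (position i)", where 'n='n]
      by (metis Suc_le_eq at_position_position le_add1 plus_1_eq_Suc)
    then show "(if position j = Suc (position i) then u $ j else 0) =
      (if j = at_position (Suc (position i)) \<and> position i < CARD('n) then u $ j else 0)"
      by simp
  qed simp
  also have "\<dots> = (if position i < CARD('n) then u $ at_position (Suc (position i)) else 0)"
    by auto
  finally show ?thesis .
qed

lemma jordan_block_0_funpow_nth:
  fixes u :: "real ^ 'n::{finite,linorder}"
  shows "(((*v) (jordan_block 0) ^^ k) u) $ i =
    (if position i + k \<le> CARD('n) then u $ at_position (position i + k) else 0)"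
proof (induction k arbitrary: i)
  case 0
  then show ?case using position_le_CARD[of i] by simp
next
  case (Suc k)
  show ?case
  proof (cases "position i < CARD('n)")
    case True
    then have "position (at_position (Suc (position i)) :: 'n) = Suc (position i)"
      by (simp add: position_at_position)
    with True show ?thesis by (simp add: jordan_block_0_nth Suc.IH)
  qed (simp add: jordan_block_0_nth)
qed

lemma jordan_block_0_nilpotent:
  "CARD('n) \<le> k \<Longrightarrow> ((*v) (jordan_block 0) ^^ k) (u :: real ^ 'n::{finite,linorder}) = 0"
proof -
  assume "CARD('n) \<le> k"
  then have "\<not> position i + k \<le> CARD('n)" for i :: 'n
    using position_ge_1[of i] by linarith
  then show ?thesis by (simp add: vec_eq_iff jordan_block_0_funpow_nth)
qed

text \<open>The top power J^(n-1) has a single nonzero entry, in the first row and last column. This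
  rank-one collapse makes the invariant forms below computable.\<close>

lemma inner_jordan_block_0_funpow:
  fixes p u :: "real ^ 'n::{finite,linorder}"
  assumes "Suc k = CARD('n)"
  shows "p \<bullet> ((*v) (jordan_block 0) ^^ k) u = p $ at_position 1 * u $ at_position CARD('n)"
proof -
  have pos1: "position (at_position 1 :: 'n) = 1"
    using position_at_position[of 1, where 'n='n] assms by linarith
  have "position i + k \<le> CARD('n) \<longleftrightarrow> i = at_position 1" for i :: 'n
  proof
    assume "position i + k \<le> CARD('n)"
    then have "position i = 1" using position_ge_1[of i] assms by linarith
    then show "i = at_position 1" by (metis at_position_position)
  qed (use pos1 assms in simp)
  then have "p \<bullet> ((*v) (jordan_block 0) ^^ k) u =
      (\<Sum>i\<in>UNIV. if i = at_position 1 then p $ i * u $ at_position (position i + k) else 0)"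
    unfolding inner_vec_def by (intro sum.cong) (simp_all add: jordan_block_0_funpow_nth)
  also have "\<dots> = p $ at_position 1 * u $ at_position (position (at_position 1 :: 'n) + k)"
    by (subst sum.delta) auto
  also have "position (at_position 1 :: 'n) + k = CARD('n)"
    using pos1 assms by linarith
  finally show ?thesis .
qed

lemma funpow_mult_vec_linear:
  fixes A :: "real ^ 'n ^ 'n"
  shows "((*v) A ^^ k) (u + v) = ((*v) A ^^ k) u + ((*v) A ^^ k) v"
    and "((*v) A ^^ k) (u - v) = ((*v) A ^^ k) u - ((*v) A ^^ k) v"
    and "((*v) A ^^ k) (r *\<^sub>R u) = r *\<^sub>R ((*v) A ^^ k) u"
    and "((*v) A ^^ k) 0 = 0"
  by (induction k)
    (auto simp: matrix_vector_right_distrib matrix_vector_mult_diff_distrib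
      scaleR_matrix_vector_assoc matrix_vector_mult_scaleR)

section \<open>The cotangent Lie algebra in coordinates\<close>

type_synonym 'n cotangent = "(real \<times> (real ^ 'n)) \<times> ((real \<times> (real ^ 'n)) \<Rightarrow>\<^sub>L real)"

text \<open>
  Coordinates of \<open>T\<^sup>*\<g>\<close>: the coefficient of \<open>t\<close>, the vector of coefficients of \<open>e\<^sub>1, \<dots>, e\<^sub>n\<close>,
  the coefficient of \<open>z\<close>, and the vector of coefficients of \<open>e\<^sup>1, \<dots>, e\<^sup>n\<close>, that is, of
  \<open>f\<^sub>n, \<dots>, f\<^sub>1\<close>.
\<close>

definition tc :: "'n::finite cotangent \<Rightarrow> real" where
  "tc X = fst (fst X)"

definition uc :: "'n::finite cotangent \<Rightarrow> real ^ 'n" where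
  "uc X = snd (fst X)"

definition zc :: "'n::finite cotangent \<Rightarrow> real" where
  "zc X = blinfun_apply (snd X) (1, 0)"

definition pc :: "'n::finite cotangent \<Rightarrow> real ^ 'n" where
  "pc X = (\<chi> i. blinfun_apply (snd X) (0, axis i 1))"

definition of_coords :: "real \<Rightarrow> real ^ 'n \<Rightarrow> real \<Rightarrow> real ^ 'n \<Rightarrow> 'n::finite cotangent" where
  "of_coords \<tau> u \<zeta> p = ((\<tau>, u), Blinfun (\<lambda>y. \<zeta> * fst y + p \<bullet> snd y))"

lemma snd_apply_coords: "blinfun_apply (snd X) (s, v) = zc X * s + pc X \<bullet> v"
proof -
  have 1: "(s, v) = s *\<^sub>R (1, 0) + (0, v)" by simp
  have 2: "(0, v) = (\<Sum>i\<in>UNIV. v $ i *\<^sub>R (0::real, axis i (1::real)))"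
  proof -
    have "v = (\<Sum>i\<in>UNIV. v $ i *\<^sub>R axis i 1)"
      by (simp add: vec_eq_iff axis_def if_distrib cong: if_cong)
    then show ?thesis
      by (simp add: prod_eq_iff fst_sum snd_sum)
  qed
  have "blinfun_apply (snd X) (0, v) = (\<Sum>i\<in>UNIV. v $ i * blinfun_apply (snd X) (0, axis i 1))"
    by (subst 2) (simp only: blinfun.sum_right blinfun.scaleR_right real_scaleR_def)
  then have 3: "snd X (0, v) = pc X \<bullet> v"
    by (simp add: pc_def inner_vec_def mult.commute)
  show ?thesis
    by (subst 1)
      (simp only: blinfun.add_right blinfun.scaleR_right 3 zc_def real_scaleR_def mult.commute)
qed

lemma coords_eqI:
  assumes "tc X = tc Y" "uc X = uc Y" "zc X = zc Y" "pc X = pc Y"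
  shows "X = Y"
proof (intro prod_eqI blinfun_eqI)
  fix y show "blinfun_apply (snd X) y = blinfun_apply (snd Y) y"
    using assms snd_apply_coords[of X "fst y" "snd y"] snd_apply_coords[of Y "fst y" "snd y"]
    by simp
qed (use assms in \<open>auto simp: tc_def uc_def\<close>)

lemma coords_linear [simp]:
  "tc (X + Y) = tc X + tc Y" "uc (X + Y) = uc X + uc Y"
  "zc (X + Y) = zc X + zc Y" "pc (X + Y) = pc X + pc Y"
  "tc (r *\<^sub>R X) = r * tc X" "uc (r *\<^sub>R X) = r *\<^sub>R uc X"
  "zc (r *\<^sub>R X) = r * zc X" "pc (r *\<^sub>R X) = r *\<^sub>R pc X"
  "tc 0 = 0" "uc 0 = 0" "zc 0 = 0" "pc 0 = 0"
  by (auto simp: tc_def uc_def zc_def pc_def vec_eq_iff blinfun.bilinear_simps)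

lemma coords_of_coords [simp]:
  "tc (of_coords \<tau> u \<zeta> p) = \<tau>" "uc (of_coords \<tau> u \<zeta> p) = u"
  "zc (of_coords \<tau> u \<zeta> p) = \<zeta>" "pc (of_coords \<tau> u \<zeta> p) = p"
proof -
  have "bounded_linear (\<lambda>y. \<zeta> * fst y + p \<bullet> snd y)"
    by (intro bounded_linear_intros)
  then have "blinfun_apply (snd (of_coords \<tau> u \<zeta> p)) y = \<zeta> * fst y + p \<bullet> snd y" for y
    by (simp add: of_coords_def bounded_linear_Blinfun_apply)
  then show "zc (of_coords \<tau> u \<zeta> p) = \<zeta>" "pc (of_coords \<tau> u \<zeta> p) = p"
    by (auto simp: zc_def pc_def vec_eq_iff inner_axis)
qed (auto simp: of_coords_def tc_def uc_def)

abbreviation cotangent_semidirect ::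
    "real ^ 'n ^ 'n \<Rightarrow> 'n::finite cotangent \<Rightarrow> 'n cotangent \<Rightarrow> 'n cotangent" where
  "cotangent_semidirect A \<equiv> cotangent_bracket (semidirect_bracket A)"

lemma coad_semidirect_apply:
  "blinfun_apply (coad (semidirect_bracket A) x \<phi>) (s, v) = - blinfun_apply \<phi> (0, fst x *\<^sub>R (A *v v) - s *\<^sub>R (A *v snd x))"
proof -
  \<comment> \<open>\<open>Blinfun\<close> represents its argument faithfully only if that is
    bounded linear.\<close>
  have "linear (semidirect_bracket A x)"
    by (rule linearI) (auto simp: semidirect_bracket_def matrix_vector_right_distrib
        matrix_vector_mult_scaleR algebra_simps)
  then have "bounded_linear (semidirect_bracket A x)"
    by (simp add: linear_conv_bounded_linear)
  then show ?thesis
    by (simp add: coad_def bounded_linear_Blinfun_apply blinfun.minus_left semidirect_bracket_def)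
qed

lemma coords_bracket [simp]:
  "tc (cotangent_semidirect A X Y) = 0"
  "uc (cotangent_semidirect A X Y) = tc X *\<^sub>R (A *v uc Y) - tc Y *\<^sub>R (A *v uc X)"
  "zc (cotangent_semidirect A X Y) = pc Y \<bullet> (A *v uc X) - pc X \<bullet> (A *v uc Y)"
  "pc (cotangent_semidirect A X Y) = tc Y *\<^sub>R (pc X v* A) - tc X *\<^sub>R (pc Y v* A)"
proof -
  have ax: "pc Z \<bullet> (A *v axis i 1) = (pc Z v* A) $ i" for Z :: "'a cotangent" and i
    by (simp add: inner_axis flip: dot_lmul_matrix)
  show "tc (cotangent_semidirect A X Y) = 0"
    "uc (cotangent_semidirect A X Y) = tc X *\<^sub>R (A *v uc Y) - tc Y *\<^sub>R (A *v uc X)"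
    by (auto simp: tc_def uc_def cotangent_bracket_def semidirect_bracket_def)
  show "zc (cotangent_semidirect A X Y) = pc Y \<bullet> (A *v uc X) - pc X \<bullet> (A *v uc Y)"
    unfolding zc_def[of "cotangent_semidirect A X Y"]
    by (simp add: cotangent_bracket_def coad_semidirect_apply minus_blinfun.rep_eq
        snd_apply_coords inner_diff_right flip: uc_def)
  show "pc (cotangent_semidirect A X Y) = tc Y *\<^sub>R (pc X v* A) - tc X *\<^sub>R (pc Y v* A)"
    unfolding vec_eq_iff pc_def[of "cotangent_semidirect A X Y"]
    by (simp add: cotangent_bracket_def coad_semidirect_apply minus_blinfun.rep_eq
        snd_apply_coords ax flip: uc_def tc_def)
qed

lemma vector_matrix_mult_linear:
  fixes A :: "real ^ 'n ^ 'm"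
  shows "(p + q) v* A = p v* A + q v* A" "(p - q) v* A = p v* A - q v* A"
    "(r *\<^sub>R p) v* A = r *\<^sub>R (p v* A)"
  by (auto simp: vector_matrix_mult_def vec_eq_iff algebra_simps sum.distrib sum_subtractf
      sum_distrib_left)

lemmas matrix_linear = matrix_vector_right_distrib matrix_vector_mult_diff_distrib
  matrix_vector_mult_scaleR vector_matrix_mult_linear

lemma lie_algebra_cotangent_semidirect: "lie_algebra (cotangent_semidirect A)"
  unfolding lie_algebra_def bilinear_def
proof (intro conjI allI)
  fix X Y Z :: "'a cotangent"
  show "linear (cotangent_semidirect A X)"
    by (rule linearI; rule coords_eqI) (simp_all add: matrix_linear algebra_simps inner_simps)
  show "linear (\<lambda>X. cotangent_semidirect A X Y)"
    by (rule linearI; rule coords_eqI) (simp_all add: matrix_linear algebra_simps inner_simps)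
  show "cotangent_semidirect A X X = 0"
    by (rule coords_eqI) simp_all
  show "cotangent_semidirect A X (cotangent_semidirect A Y Z) +
      cotangent_semidirect A Y (cotangent_semidirect A Z X) +
      cotangent_semidirect A Z (cotangent_semidirect A X Y) = 0"
    by (rule coords_eqI)
      (simp_all add: matrix_linear inner_simps dot_lmul_matrix algebra_simps)
qed

section \<open>Symplectic forms from derivations\<close>

text \<open>
  The form \<open>\<langle>\<D> x, y\<rangle>\<close>, where \<open>\<langle>\<cdot>, \<cdot>\<rangle>\<close> is the duality pairing and \<open>\<D>\<close> acts on \<open>t\<close>, \<open>\<real>\<^sup>n\<close>, \<open>z\<close>,
  \<open>(\<real>\<^sup>n)\<^sup>*\<close> as \<open>1\<close>, \<open>D\<close>, \<open>-1\<close>, \<open>-D\<^sup>T\<close>. The pairing is ad-invariant, so this form is closed iff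
  \<open>\<D>\<close> is a derivation.
\<close>

definition derivation_form :: "real ^ 'n ^ 'n \<Rightarrow> 'n::finite cotangent \<Rightarrow> 'n cotangent \<Rightarrow> real" where
  "derivation_form D X Y =
    tc X * zc Y - zc X * tc Y + (D *v uc X) \<bullet> pc Y - (D *v uc Y) \<bullet> pc X"

text \<open>\<open>comm\<close> is the derivation rule for [t, u] = A u with t of weight 1, whence
  closedness. Non-degeneracy holds because t, z have weights 1, -1 and \<open>D\<close> is
  invertible.\<close>

lemma symplectic_derivation_form:
  fixes A D :: "real ^ 'n::finite ^ 'n"
  assumes "invertible D" and comm: "\<And>u. D *v (A *v u) = A *v (D *v u) + A *v u"
  shows "symplectic_structure (cotangent_semidirect A) (derivation_form D)"
  unfolding symplectic_structure_def bilinear_def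
proof (intro conjI allI impI)
  fix X Y Z :: "'n cotangent"
  show "linear (derivation_form D X)"
    by (rule linearI) (simp_all add: derivation_form_def matrix_linear algebra_simps inner_simps)
  show "linear (\<lambda>X. derivation_form D X Y)"
    by (rule linearI) (simp_all add: derivation_form_def matrix_linear algebra_simps inner_simps)
  show "derivation_form D X Y = - derivation_form D Y X"
    by (simp add: derivation_form_def)
  show "derivation_form D X (cotangent_semidirect A Y Z) +
      derivation_form D Y (cotangent_semidirect A Z X) +
      derivation_form D Z (cotangent_semidirect A X Y) = 0"
    by (simp add: derivation_form_def matrix_linear inner_simps comm dot_lmul_matrix
        inner_commute[of _ "_ v* _"] inner_commute[of _ "pc _"] algebra_simps)
  assume 0: "\<forall>Y. derivation_form D X Y = 0"
  obtain D' where D': "D' ** D = mat 1" "D ** D' = mat 1"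
    using \<open>invertible D\<close> unfolding invertible_def by blast
  show "X = 0"
  proof (rule coords_eqI)
    show "tc X = tc 0" using 0[rule_format, of "of_coords 0 0 1 0"]
      by (simp add: derivation_form_def)
    show "zc X = zc 0" using 0[rule_format, of "of_coords 1 0 0 0"]
      by (simp add: derivation_form_def)
    \<comment> \<open>Pairing X with the covector D u gives |D u|^2; below, pairing with the vector
      D' p gives -|p|^2.\<close>
    have "D *v uc X = 0" using 0[rule_format, of "of_coords 0 0 0 (D *v uc X)"]
      by (simp add: derivation_form_def)
    then show "uc X = uc 0"
      using D' by (metis coords_linear(10) matrix_vector_mul_assoc matrix_vector_mul_lid
          matrix_vector_mult_0_right)
    have "D *v (D' *v pc X) = pc X"
      using D' by (simp add: matrix_vector_mul_assoc)
    then show "pc X = pc 0" using 0[rule_format, of "of_coords 0 (D' *v pc X) 0 0"]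
      by (simp add: derivation_form_def)
  qed
qed

section \<open>Powers of ad and the nilpotency step\<close>

text \<open>The first bracket kills the t-coefficient; afterwards ad X acts as \<open>tc X\<close>
  times A on the vector part and as \<open>- tc X\<close> times the transpose of A on the dual part.
  Pairing the dual part with v turns powers of the transpose into powers of A.\<close>

lemma coords_ad_funpow:
  fixes A :: "real ^ 'n::finite ^ 'n" and X Y k
  defines "N \<equiv> \<lambda>k. (*v) A ^^ k" and "W \<equiv> (cotangent_semidirect A X ^^ k) Y"
  assumes "k > 0"
  shows "tc W = 0 \<and>
    uc W = tc X ^ (k - 1) *\<^sub>R N k (tc X *\<^sub>R uc Y - tc Y *\<^sub>R uc X) \<and>
    (\<forall>v. pc W \<bullet> v =
      (-1) ^ k * tc X ^ (k - 1) * ((tc X *\<^sub>R pc Y - tc Y *\<^sub>R pc X) \<bullet> N k v))"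
  using \<open>k > 0\<close> unfolding W_def
proof (induction k rule: nat_induct_non_zero)
  case 1
  show ?case by (simp add: N_def matrix_linear inner_simps dot_lmul_matrix)
next
  case (Suc k)
  let ?V = "(cotangent_semidirect A X ^^ k) Y"
  have V: "(cotangent_semidirect A X ^^ Suc k) Y = cotangent_semidirect A X ?V"
    by simp
  have N: "N (Suc k) v = A *v N k v" "N k (A *v v) = A *v N k v" for v
    by (simp_all add: N_def funpow_swap1)
  have "tc X * tc X ^ (k - 1) = tc X ^ (Suc k - 1)"
    using \<open>k > 0\<close> by (cases k) auto
  then show ?case
    unfolding V using Suc.IH
    by (simp add: N matrix_linear inner_simps dot_lmul_matrix flip: mult.assoc)
qed

text \<open>One more bracket after \<open>coords_ad_funpow\<close> pairs its vector and dual parts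
  with X. The formula serves the case n >= 3 of an image of t without t-component.\<close>

lemma zc_ad_funpow:
  fixes A :: "real ^ 'n::finite ^ 'n" and X Y
  defines "N \<equiv> \<lambda>k. (*v) A ^^ k"
  assumes "k > 0"
  shows "zc ((cotangent_semidirect A X ^^ Suc k) Y) = tc X ^ (k - 1) *
    ((-1) ^ k * ((tc X *\<^sub>R pc Y - tc Y *\<^sub>R pc X) \<bullet> N (Suc k) (uc X)) -
     pc X \<bullet> N (Suc k) (tc X *\<^sub>R uc Y - tc Y *\<^sub>R uc X))"
proof -
  let ?V = "(cotangent_semidirect A X ^^ k) Y"
  have V: "(cotangent_semidirect A X ^^ Suc k) Y = cotangent_semidirect A X ?V"
    by simp
  have N: "N (Suc k) v = A *v N k v" "N k (A *v v) = A *v N k v" for v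
    by (simp_all add: N_def funpow_swap1)
  have "zc (cotangent_semidirect A X ?V) = pc ?V \<bullet> (A *v uc X) - pc X \<bullet> (A *v uc ?V)"
    by simp
  also have "pc ?V \<bullet> (A *v uc X) = (-1) ^ k * tc X ^ (k - 1) *
      ((tc X *\<^sub>R pc Y - tc Y *\<^sub>R pc X) \<bullet> N (Suc k) (uc X))"
    unfolding N(1) N(2)[symmetric] using coords_ad_funpow[OF assms(2), of A X Y]
    unfolding N_def by blast
  also have "A *v uc ?V = tc X ^ (k - 1) *\<^sub>R N (Suc k) (tc X *\<^sub>R uc Y - tc Y *\<^sub>R uc X)"
    unfolding N(1) using coords_ad_funpow[OF assms(2), of A X Y]
    by (simp add: N_def matrix_vector_mult_scaleR)
  finally show ?thesis
    unfolding V by (simp add: algebra_simps)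
qed

lemma ad_funpow_in_lower_central_series:
  "(br x ^^ k) y \<in> lower_central_series br k"
  by (induction k) (auto intro!: span_base)

lemma nilpotent_cotangent_jordan_block:
  fixes J :: "real ^ 'n::{finite,linorder} ^ 'n::{finite,linorder}"
  defines "J \<equiv> jordan_block 0" and "L \<equiv> cotangent_semidirect J"
  assumes n: "CARD('n) \<ge> 2"
  shows "nilpotent_of_step L CARD('n)"
  unfolding nilpotent_of_step_def
proof (intro conjI allI impI)
  define N where "N = (\<lambda>k. (*v) J ^^ k)"
  have N0: "N k u = 0" if "CARD('n) \<le> k" for k u
    using that by (simp add: N_def J_def jordan_block_0_nilpotent)
  have NJ: "N k (J *v u) = N (Suc k) u" "J *v N k u = N (Suc k) u" for k u
    by (simp_all add: N_def funpow_swap1)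
  \<comment> \<open>The vector part lies in the kernel of J^(n-k) and the dual part annihilates its
    image; z is left free. For 1 \<le> k, each bracket lowers the exponent by one.\<close>
  define F where "F = (\<lambda>k. {X :: 'n cotangent. tc X = 0 \<and> N (CARD('n) - k) (uc X) = 0
    \<and> (\<forall>v. pc X \<bullet> N (CARD('n) - k) v = 0)})"
  have subF: "subspace (F k)" for k
    unfolding subspace_def F_def N_def by (auto simp: inner_simps funpow_mult_vec_linear)
  have step: "span {L X Y | X Y. Y \<in> S} \<subseteq> F j" if "\<And>X Y. Y \<in> S \<Longrightarrow> L X Y \<in> F j" for S j
    using that by (intro span_minimal subF) blast
  have F: "lower_central_series L k \<subseteq> F k" if "1 \<le> k" "k < CARD('n)" for k
    using that
  proof (induction k rule: nat_induct_at_least)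
    case base
    have "L X Y \<in> F 1" for X Y
    proof -
      have "N (CARD('n) - 1) (J *v v) = 0" "J *v N (CARD('n) - 1) v = 0" for v
        using n N0[of "CARD('n)" v] by (simp_all add: NJ)
      then show ?thesis
        by (simp add: F_def L_def inner_simps dot_lmul_matrix)
          (simp add: N_def funpow_mult_vec_linear)
    qed
    then show ?case using step[of UNIV 1] by (simp del: split_paired_Ex)
  next
    case (Suc k)
    then have k: "CARD('n) - k = Suc (CARD('n) - Suc k)" by simp
    have "L X Y \<in> F (Suc k)" if "Y \<in> F k" for X Y
      using that unfolding F_def k
      by (simp add: L_def inner_simps dot_lmul_matrix NJ)
        (simp add: N_def funpow_mult_vec_linear funpow_swap1)
    then show ?case
      unfolding lower_central_series.simps using Suc by (intro step) auto
  qed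
  \<comment> \<open>The bound \<open>F\<close> would still leave the z-axis in degree n, so the last
    step uses instead that degree n - 1 is central.\<close>
  have "L X Y = 0" if "Y \<in> lower_central_series L (CARD('n) - 1)" for X Y
  proof -
    have "lower_central_series L (CARD('n) - 1) \<subseteq> F (CARD('n) - 1)"
      using n by (intro F) auto
    with that have "Y \<in> F (CARD('n) - 1)" by (rule rev_subsetD)
    then have Y: "tc Y = 0" "J *v uc Y = 0" "\<And>v. pc Y \<bullet> (J *v v) = 0"
      using n by (auto simp: F_def N_def)
    from Y(3) have "pc Y v* J = 0"
      by (metis dot_lmul_matrix inner_eq_zero_iff)
    with Y show ?thesis by (intro coords_eqI) (simp_all add: L_def)
  qed
  then have "lower_central_series L (Suc (CARD('n) - 1)) \<subseteq> {0}"
    unfolding lower_central_series.simps by (intro span_minimal subspace_single_0) blast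
  moreover have "0 \<in> lower_central_series L (Suc (CARD('n) - 1))"
    unfolding lower_central_series.simps by (rule span_zero)
  moreover have "Suc (CARD('n) - 1) = CARD('n)" by simp
  ultimately show "lower_central_series L CARD('n) = {0}"
    by (metis subset_antisym empty_subsetI insert_subset)
next
  fix j assume j: "j < CARD('n)"
  \<comment> \<open>Lower bound: (ad t)^j e_n = e_(n-j), which is nonzero for j < n.\<close>
  define T :: "'n cotangent" where "T = of_coords 1 0 0 0"
  define E :: "'n cotangent" where "E = of_coords 0 (axis (at_position CARD('n)) 1) 0 0"
  let ?N = "\<lambda>k. (*v) J ^^ k"
  have "uc ((L T ^^ k) E) = ?N k (uc E)" for k
    by (induction k) (simp_all add: L_def T_def)
  moreover have "?N j (uc E) $ at_position (CARD('n) - j) = 1"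
    using j by (simp add: E_def J_def jordan_block_0_funpow_nth position_at_position)
  ultimately have "uc ((L T ^^ j) E) \<noteq> 0"
    by (metis zero_index zero_neq_one)
  then have "(L T ^^ j) E \<noteq> 0" by (metis coords_linear(10))
  then show "lower_central_series L j \<noteq> {0}"
    using ad_funpow_in_lower_central_series[of j L T E] by auto
qed

section \<open>The one-parameter family and its invariant forms\<close>

definition weight_matrix :: "real \<Rightarrow> real ^ 'n::{finite,linorder} ^ 'n::{finite,linorder}" where
  "weight_matrix \<mu> = (\<chi> i j. if i = j then \<mu> + CARD('n) - position i else 0)"

lemma weight_matrix_nth:
  fixes u :: "real ^ 'n::{finite,linorder}"
  shows "(weight_matrix \<mu> *v u) $ i = (\<mu> + CARD('n) - position i) * u $ i"
proof -
  have "weight_matrix \<mu> $ i $ j * u $ j =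
      (if i = j then (\<mu> + CARD('n) - position j) * u $ j else 0)" for j
    by (simp add: weight_matrix_def)
  then show ?thesis by (simp add: matrix_vector_mult_def)
qed

lemma invertible_weight_matrix:
  assumes "\<mu> > 0"
  shows "invertible (weight_matrix \<mu> :: real ^ 'n::{finite,linorder} ^ 'n::{finite,linorder})"
proof -
  have "u = 0" if "weight_matrix \<mu> *v u = 0" for u :: "real ^ 'n::{finite,linorder}"
  proof -
    have "\<mu> + CARD('n) - position i \<noteq> 0" for i :: 'n
      using assms position_le_CARD[of i] by linarith
    moreover have "(\<mu> + CARD('n) - position i) * u $ i = 0" for i
      using that weight_matrix_nth[of \<mu> u i] by simp
    ultimately show ?thesis by (simp add: vec_eq_iff)
  qed
  then show ?thesis
    by (simp add: invertible_left_inverse matrix_left_invertible_ker)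
qed

text \<open>J moves e_(i+1) to e_i, whose weight is larger by 1. This supplies \<open>comm\<close>
  in \<open>symplectic_derivation_form\<close>.\<close>

lemma weight_matrix_jordan_block:
  fixes u :: "real ^ 'n::{finite,linorder}"
  shows "weight_matrix \<mu> *v (jordan_block 0 *v u) =
    jordan_block 0 *v (weight_matrix \<mu> *v u) + jordan_block 0 *v u"
  by (auto simp: vec_eq_iff weight_matrix_nth jordan_block_0_nth position_at_position
      of_nat_Suc algebra_simps)

abbreviation weight_form :: "real \<Rightarrow> 'n::{finite,linorder} cotangent \<Rightarrow> 'n cotangent \<Rightarrow> real" where
  "weight_form \<mu> \<equiv> derivation_form (weight_matrix \<mu>)"

definition ad_form ::
    "('a \<Rightarrow> 'a \<Rightarrow> 'a) \<Rightarrow> ('a \<Rightarrow> 'a \<Rightarrow> real) \<Rightarrow> nat \<Rightarrow> 'a \<Rightarrow> 'a \<Rightarrow> 'a \<Rightarrow> real" where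
  "ad_form br \<omega> k X Y W = \<omega> W ((br X ^^ k) Y)"

lemma ad_form_automorphism:
  assumes "lie_automorphism br \<phi>" and "\<forall>X Y. \<omega>' (\<phi> X) (\<phi> Y) = c * \<omega> X Y"
  shows "ad_form br \<omega>' k (\<phi> X) (\<phi> Y) (\<phi> W) = c * ad_form br \<omega> k X Y W"
proof -
  have "(br (\<phi> X) ^^ k) (\<phi> Y) = \<phi> ((br X ^^ k) Y)"
    using assms(1) by (induction k) (auto simp: lie_automorphism_def)
  then show ?thesis using assms(2) by (simp add: ad_form_def)
qed

text \<open>Since J^(n-1) has rank one, only the coefficients \<alpha> of e_n and \<beta> of f_n =
  e^1 survive in the first summand, with the weights \<mu> of e_n and \<mu> + n - 1 of e_1. The
  z-coefficient meets only the t-coefficient of W.\<close>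

lemma ad_form_weight_form:
  fixes X Y W :: "'n::{finite,linorder} cotangent" and \<mu> :: real
  defines "\<alpha> \<equiv> \<lambda>X :: 'n cotangent. uc X $ at_position CARD('n)"
    and "\<beta> \<equiv> \<lambda>X :: 'n cotangent. pc X $ at_position 1"
    and "L \<equiv> cotangent_semidirect (jordan_block 0)"
  assumes k: "CARD('n) = Suc (Suc k)"
  shows "ad_form L (weight_form \<mu>) (Suc k) X Y W = tc X ^ k *
      ((-1) ^ Suc k * \<mu> * \<alpha> W * (tc X * \<beta> Y - tc Y * \<beta> X) -
       (\<mu> + Suc k) * \<beta> W * (tc X * \<alpha> Y - tc Y * \<alpha> X)) +
      tc W * zc ((L X ^^ Suc k) Y)"
proof -
  let ?N = "(*v) (jordan_block 0) ^^ Suc k"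
  let ?V = "(L X ^^ Suc k) Y"
  let ?D = "weight_matrix \<mu>"
  have pos: "position (at_position 1 :: 'n) = 1" "position (at_position CARD('n) :: 'n) = CARD('n)"
    using k by (simp_all add: position_at_position)
  note inner_N = inner_jordan_block_0_funpow[of "Suc k", where 'n='n, OF k[symmetric]]
  have V: "tc ?V = 0"
    "uc ?V = tc X ^ k *\<^sub>R ?N (tc X *\<^sub>R uc Y - tc Y *\<^sub>R uc X)"
    "\<And>v. pc ?V \<bullet> v = (-1) ^ Suc k * tc X ^ k * ((tc X *\<^sub>R pc Y - tc Y *\<^sub>R pc X) \<bullet> ?N v)"
    using coords_ad_funpow[OF zero_less_Suc[of k], of "jordan_block 0" X Y]
    unfolding L_def diff_Suc_1 by blast+
  have "(?D *v uc W) \<bullet> pc ?V =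
      (-1) ^ Suc k * tc X ^ k * ((tc X * \<beta> Y - tc Y * \<beta> X) * (\<mu> * \<alpha> W))"
    unfolding inner_commute[of "?D *v uc W"] V(3) inner_N
    by (simp add: weight_matrix_nth pos \<alpha>_def \<beta>_def)
  moreover have "(?D *v uc ?V) \<bullet> pc W =
      tc X ^ k * ((\<mu> + Suc k) * (\<beta> W * (tc X * \<alpha> Y - tc Y * \<alpha> X)))"
  proof -
    \<comment> \<open>The diagonal matrix is self-adjoint; moving it onto \<open>pc W\<close>
      exposes the top power of J.\<close>
    have "(?D *v v) \<bullet> pc W = (?D *v pc W) \<bullet> v" for v
      by (simp add: inner_vec_def weight_matrix_nth mult_ac)
    then have "(?D *v uc ?V) \<bullet> pc W = tc X ^ k *
        ((?D *v pc W) \<bullet> ?N (tc X *\<^sub>R uc Y - tc Y *\<^sub>R uc X))"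
      unfolding V(2) by simp
    then show ?thesis
      unfolding inner_N weight_matrix_nth pos \<alpha>_def \<beta>_def by (simp add: k mult_ac)
  qed
  ultimately show ?thesis
    unfolding ad_form_def derivation_form_def V(1) by (simp add: algebra_simps)
qed

text \<open>Isotropy and a + b \<noteq> 0 put each of the vectors (p, q) and (p', q') on a
  coordinate axis, and g \<noteq> 0 makes the axes different. The two mixed values are then
  proportional to a and b, in one order or the other.\<close>

lemma two_term_form_ratio:
  fixes a b c p q p' q' r :: real
  assumes "a + b \<noteq> 0" "r \<noteq> 0" "c \<noteq> 0" "g \<noteq> 0"
    and "r * (a * p * q + b * q * p) = 0" "r * (a * p' * q' + b * q' * p') = 0"
    and g: "r * (a * p * q' + b * q * p') = c * g" and h: "r * (a * p' * q + b * q' * p) = c * h"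
  shows "g * b = h * a \<or> g * a = h * b"
proof -
  have "a * p * q + b * q * p = 0" "a * p' * q' + b * q' * p' = 0"
    using assms(2,5,6) by (simp_all only: mult_eq_0_iff simp_thms)
  then have "(a + b) * (p * q) = 0" "(a + b) * (p' * q') = 0"
    by (simp_all add: algebra_simps)
  then have "p = 0 \<or> q = 0" "p' = 0 \<or> q' = 0" using assms(1) by auto
  moreover have "c * g \<noteq> 0" using assms by simp
  ultimately have "p = 0 \<and> q' = 0 \<or> q = 0 \<and> p' = 0" using g by auto
  then have "(c * g) * b = (c * h) * a \<or> (c * g) * a = (c * h) * b"
    unfolding g[symmetric] h[symmetric] by auto
  then show ?thesis using \<open>c \<noteq> 0\<close> by (simp only: mult.assoc mult_cancel_left simp_thms)
qed

section \<open>Recovering the parameter from the homothety class\<close>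

text \<open>If the image x of t has a t-component, comparing ratios gives \<mu> = \<nu>. Otherwise a
  contradiction arises, by symmetry for n >= 3 and by impossible ratios for n = 2.\<close>

lemma symplectomorphic_weight_forms_eq:
  fixes \<mu> \<nu> :: real
  defines "L \<equiv> cotangent_semidirect
    (jordan_block 0 :: real ^ 'n::{finite,linorder} ^ 'n::{finite,linorder})"
  assumes n: "CARD('n) \<ge> 2" and "\<mu> > 1" "\<nu> > 1"
    and "symplectomorphic_up_to_homothety L (weight_form \<mu>) (weight_form \<nu>)"
  shows "\<mu> = \<nu>"
proof -
  obtain k where k: "CARD('n) = Suc (Suc k)"
    using n by (metis add_2_eq_Suc le_Suc_ex)
  obtain \<phi> c where \<phi>: "lie_automorphism L \<phi>" "c \<noteq> 0"
      "\<forall>X Y. weight_form \<nu> (\<phi> X) (\<phi> Y) = c * weight_form \<mu> X Y"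
    using assms unfolding symplectomorphic_up_to_homothety_def by blast
  define \<alpha> where "\<alpha> = (\<lambda>X :: 'n cotangent. uc X $ at_position CARD('n))"
  define \<beta> where "\<beta> = (\<lambda>X :: 'n cotangent. pc X $ at_position 1)"
  define Z where "Z = (\<lambda>X Y. zc ((L X ^^ Suc k) Y))"
  \<comment> \<open>The sign that n - 1 brackets with t put on the dual part.\<close>
  define s :: real where "s = (-1) ^ Suc k"
  have s: "s = 1 \<or> s = -1" by (simp add: s_def minus_one_power_iff)
  define B where "B = (\<lambda>\<mu>. ad_form L (weight_form \<mu>) (Suc k))"
  have B: "B \<mu> X Y W = tc X ^ k *
      (s * \<mu> * \<alpha> W * (tc X * \<beta> Y - tc Y * \<beta> X) -
       (\<mu> + Suc k) * \<beta> W * (tc X * \<alpha> Y - tc Y * \<alpha> X)) + tc W * Z X Y" for \<mu> X Y W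
    unfolding B_def \<alpha>_def \<beta>_def Z_def s_def L_def by (rule ad_form_weight_form[OF k])
  define T :: "'n cotangent" where "T = of_coords 1 0 0 0"
  define E :: "'n cotangent" where "E = of_coords 0 (axis (at_position CARD('n)) 1) 0 0"
  define F :: "'n cotangent" where "F = of_coords 0 0 0 (axis (at_position 1) 1)"
  have TEF: "tc T = 1" "\<alpha> T = 0" "\<beta> T = 0" "tc E = 0" "\<alpha> E = 1" "\<beta> E = 0"
      "tc F = 0" "\<alpha> F = 0" "\<beta> F = 1"
    by (simp_all add: T_def E_def F_def \<alpha>_def \<beta>_def)
  \<comment> \<open>Brackets with t preserve the span of the e_i and that of the e^i, so z never
    appears.\<close>
  have ZT: "Z T E = 0" "Z T F = 0"
  proof -
    have "zc ((L T ^^ j) E) = 0 \<and> pc ((L T ^^ j) E) = 0" for j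
      by (induction j) (simp_all add: L_def T_def E_def)
    then show "Z T E = 0" unfolding Z_def by (rule conjunct1)
    have "zc ((L T ^^ j) F) = 0 \<and> uc ((L T ^^ j) F) = 0" for j
      by (induction j) (simp_all add: L_def T_def F_def)
    then show "Z T F = 0" unfolding Z_def by (rule conjunct1)
  qed
  define x where "x = \<phi> T"
  define y where "y = \<phi> E"
  define w where "w = \<phi> F"
  have "B \<nu> (\<phi> X) (\<phi> Y) (\<phi> W) = c * B \<mu> X Y W" for X Y W
    unfolding B_def by (rule ad_form_automorphism[OF \<phi>(1,3)])
  then have Bc: "B \<nu> x y w = c * B \<mu> T E F" "B \<nu> x w y = c * B \<mu> T F E"
      "B \<nu> x y y = c * B \<mu> T E E" "B \<nu> x w w = c * B \<mu> T F F"
      "B \<nu> x y x = c * B \<mu> T E T" "B \<nu> x w x = c * B \<mu> T F T"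
    unfolding x_def y_def w_def by auto
  have Bx: "B \<nu> x y w = - c * (\<mu> + Suc k)" "B \<nu> x w y = c * s * \<mu>"
      "B \<nu> x y y = 0" "B \<nu> x w w = 0" "B \<nu> x y x = 0" "B \<nu> x w x = 0"
    unfolding Bc by (simp_all add: B TEF ZT algebra_simps)
  have nz: "c * (\<mu> + Suc k) \<noteq> 0" using \<phi>(2) \<open>\<mu> > 1\<close> by simp
  show ?thesis
  proof (cases "tc x = 0")
    case False
    define p where "p = (\<lambda>Y. tc x * \<alpha> Y - tc Y * \<alpha> x)"
    define q where "q = (\<lambda>Y. tc x * \<beta> Y - tc Y * \<beta> x)"
    define a where "a = - (\<nu> + Suc k)"
    define b where "b = s * \<nu>"
    \<comment> \<open>Since \<open>B \<nu> x Y x = 0\<close>, the argument \<open>W\<close> may be replaced by \<open>W - (tc W / tc x) x\<close>, which has no \<open>t\<close>-component.\<close>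
    have red: "tc x * B \<nu> x Y W - tc W * B \<nu> x Y x =
        tc x ^ k * (a * p Y * q W + b * q Y * p W)" for Y W
      unfolding B p_def q_def a_def b_def by (simp add: algebra_simps)
    have "a + b \<noteq> 0" unfolding a_def b_def using s \<open>\<nu> > 1\<close> by auto
    have form: "tc x ^ k * (a * p Y * q W + b * q Y * p W) = tc x * B \<nu> x Y W"
      if "B \<nu> x Y x = 0" for Y W
      using red[of Y W] that by simp
    have "- (\<mu> + Suc k) * b = s * \<mu> * a \<or> - (\<mu> + Suc k) * a = s * \<mu> * b"
    proof (rule two_term_form_ratio[OF \<open>a + b \<noteq> 0\<close>])
      show "tc x ^ k \<noteq> 0" "tc x * c \<noteq> 0" "- (\<mu> + Suc k) \<noteq> 0"
        using False \<phi>(2) \<open>\<mu> > 1\<close> by simp_all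
      show "tc x ^ k * (a * p y * q y + b * q y * p y) = 0"
        "tc x ^ k * (a * p w * q w + b * q w * p w) = 0"
        "tc x ^ k * (a * p y * q w + b * q y * p w) = tc x * c * - (\<mu> + Suc k)"
        "tc x ^ k * (a * p w * q y + b * q w * p y) = tc x * c * (s * \<mu>)"
        unfolding form[OF Bx(5)] form[OF Bx(6)] Bx by (simp_all add: algebra_simps)
    qed
    then have "(\<mu> + Suc k) * b = - s * \<mu> * a \<or> (\<mu> + Suc k) * a = - s * \<mu> * b"
      by (simp only: mult_minus_left minus_equation_iff equation_minus_iff) auto
    \<comment> \<open>The swapped ratio would give (\<mu> + n - 1)(\<nu> + n - 1) =
      \<mu>\<nu>.\<close>
    moreover have "(\<mu> + Suc k) * a \<noteq> - s * \<mu> * b"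
    proof -
      have "\<mu> * \<nu> < (\<mu> + Suc k) * (\<nu> + Suc k)"
        using \<open>\<mu> > 1\<close> \<open>\<nu> > 1\<close> by (intro mult_strict_mono) auto
      moreover have "- s * \<mu> * b = - (\<mu> * \<nu>)" using s by (auto simp: b_def)
      ultimately show ?thesis
        unfolding a_def mult_minus_right
        by (simp only: neg_equal_iff_equal less_imp_neq not_False_eq_True)
    qed
    ultimately have "(\<mu> + Suc k) * b = - s * \<mu> * a" by blast
    then have "(\<mu> + Suc k) * \<nu> = \<mu> * (\<nu> + Suc k)"
      using s unfolding a_def b_def by (auto simp: algebra_simps)
    then have "Suc k * \<nu> = Suc k * \<mu>" by (simp add: algebra_simps)
    then show ?thesis by simp
  next
    case x: True
    show ?thesis
    proof (cases k)
      case (Suc m)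
      \<comment> \<open>For \<open>n \<ge> 3\<close> and \<open>x\<close> without \<open>t\<close>-component the form \<open>B\<close> is symmetric, so the ratio would be \<open>1\<close>.\<close>
      have "Z x Y = 0 ^ m * ((s + 1) * \<alpha> x * \<beta> x) * tc Y" for Y
      proof -
        have "Z x Y = tc x ^ m *
            ((-1) ^ Suc m * ((tc x *\<^sub>R pc Y - tc Y *\<^sub>R pc x) $ at_position 1 * \<alpha> x) -
             \<beta> x * (tc x *\<^sub>R uc Y - tc Y *\<^sub>R uc x) $ at_position CARD('n))"
          unfolding Z_def L_def Suc zc_ad_funpow[OF zero_less_Suc] diff_Suc_1
            inner_jordan_block_0_funpow[OF k[unfolded Suc, symmetric]] \<alpha>_def \<beta>_def ..
        then show ?thesis
          by (simp add: x s_def Suc \<alpha>_def \<beta>_def algebra_simps)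
      qed
      \<comment> \<open>As k > 0, the first summand of \<open>B\<close> vanishes. The factor
        \<open>0 ^ m\<close> is 1 exactly for n = 3; even then the rest is a multiple of
        \<open>tc Y * tc W\<close>.\<close>
      then have "B \<nu> x y w = B \<nu> x w y" unfolding B x Suc by simp
      then have "c * (\<mu> + Suc k) = c * (- s * \<mu>)" unfolding Bx by simp
      then have "\<mu> + Suc k = - s * \<mu>" using \<phi>(2) by (simp only: mult_cancel_left simp_thms)
      then show ?thesis using s \<open>\<mu> > 1\<close> by auto
    next
      case 0
      \<comment> \<open>For n = 2 the algebra is free 2-step nilpotent on t, e_2, f_2, so
        automorphisms can remove the t-component of x; the ratios must exclude this.\<close>
      then have "s = -1" by (simp add: s_def)
      have "Z x Y = \<alpha> x * \<beta> Y - \<beta> x * \<alpha> Y" for Y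
        using inner_jordan_block_0_funpow[of "Suc 0", where 'n='n] k 0
        unfolding Z_def L_def \<alpha>_def \<beta>_def by simp
      then have B2: "B \<nu> x Y W = \<nu> * \<alpha> W * tc Y * \<beta> x + (\<nu> + 1) * \<beta> W * tc Y * \<alpha> x +
          tc W * (\<alpha> x * \<beta> Y - \<beta> x * \<alpha> Y)" for Y W
        unfolding B x 0 \<open>s = -1\<close> by simp
      \<comment> \<open>Inserting x itself as last argument isolates
        \<open>\<alpha> x * \<beta> x\<close>, which must vanish because y or w has a
        t-component.\<close>
      have "(2 * \<nu> + 1) * (\<alpha> x * \<beta> x * tc y) = 0" "(2 * \<nu> + 1) * (\<alpha> x * \<beta> x * tc w) = 0"
        using Bx(5,6) unfolding B2 x by (simp_all add: algebra_simps)
      then have "\<alpha> x * \<beta> x * tc y = 0" "\<alpha> x * \<beta> x * tc w = 0"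
        using \<open>\<nu> > 1\<close> by simp_all
      moreover have "tc y \<noteq> 0 \<or> tc w \<noteq> 0"
        using Bx(1) nz unfolding B2 by auto
      ultimately consider "\<beta> x = 0" | "\<alpha> x = 0" by auto
      then show ?thesis
      proof cases
        case 1
        have f: "\<alpha> x * ((\<nu> + 1) * tc Y * \<beta> W + 1 * \<beta> Y * tc W) = B \<nu> x Y W" for Y W
          unfolding B2 1 by (simp add: algebra_simps)
        have "- (\<mu> + 1) * 1 = - \<mu> * (\<nu> + 1) \<or> - (\<mu> + 1) * (\<nu> + 1) = - \<mu> * 1"
        proof (rule two_term_form_ratio)
          show "\<nu> + 1 + 1 \<noteq> 0" "\<alpha> x \<noteq> 0" "c \<noteq> 0" "- (\<mu> + 1) \<noteq> 0"
            using \<open>\<nu> > 1\<close> \<open>\<mu> > 1\<close> \<phi>(2) Bx(1) nz unfolding B2 1 by auto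
          show "\<alpha> x * ((\<nu> + 1) * tc y * \<beta> y + 1 * \<beta> y * tc y) = 0"
            "\<alpha> x * ((\<nu> + 1) * tc w * \<beta> w + 1 * \<beta> w * tc w) = 0"
            "\<alpha> x * ((\<nu> + 1) * tc y * \<beta> w + 1 * \<beta> y * tc w) = c * - (\<mu> + 1)"
            "\<alpha> x * ((\<nu> + 1) * tc w * \<beta> y + 1 * \<beta> w * tc y) = c * - \<mu>"
            unfolding f Bx 0 \<open>s = -1\<close> by (simp_all add: algebra_simps)
        qed
        \<comment> \<open>The first ratio says \<mu>\<nu> = 1, the second (\<mu> + 1)(\<nu> + 1) =
          \<mu>.\<close>
        moreover have "\<mu> * \<nu> > 1" using \<open>\<mu> > 1\<close> \<open>\<nu> > 1\<close> by (simp add: less_1_mult)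
        ultimately show ?thesis using \<open>\<mu> > 1\<close> \<open>\<nu> > 1\<close> by (auto simp: algebra_simps)
      next
        case 2
        have f: "\<beta> x * (\<nu> * tc Y * \<alpha> W + (- 1) * \<alpha> Y * tc W) = B \<nu> x Y W" for Y W
          unfolding B2 2 by (simp add: algebra_simps)
        have "- (\<mu> + 1) * (- 1) = - \<mu> * \<nu> \<or> - (\<mu> + 1) * \<nu> = - \<mu> * (- 1)"
        proof (rule two_term_form_ratio)
          show "\<nu> + - 1 \<noteq> 0" "\<beta> x \<noteq> 0" "c \<noteq> 0" "- (\<mu> + 1) \<noteq> 0"
            using \<open>\<nu> > 1\<close> \<open>\<mu> > 1\<close> \<phi>(2) Bx(1) nz unfolding B2 2 by auto
          show "\<beta> x * (\<nu> * tc y * \<alpha> y + (- 1) * \<alpha> y * tc y) = 0"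
            "\<beta> x * (\<nu> * tc w * \<alpha> w + (- 1) * \<alpha> w * tc w) = 0"
            "\<beta> x * (\<nu> * tc y * \<alpha> w + (- 1) * \<alpha> y * tc w) = c * - (\<mu> + 1)"
            "\<beta> x * (\<nu> * tc w * \<alpha> y + (- 1) * \<alpha> w * tc y) = c * - \<mu>"
            unfolding f Bx 0 \<open>s = -1\<close> by (simp_all add: algebra_simps)
        qed
        \<comment> \<open>Both ratios equate a positive and a negative number.\<close>
        moreover have "\<mu> * \<nu> > 1" using \<open>\<mu> > 1\<close> \<open>\<nu> > 1\<close> by (simp add: less_1_mult)
        ultimately show ?thesis using \<open>\<mu> > 1\<close> \<open>\<nu> > 1\<close> by (auto simp: algebra_simps)
      qed
    qed
  qed
qed

section \<open>The uncountable family\<close>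

theorem corollary4p7:
  fixes n :: nat
    and J :: "real ^ 'n::{finite,linorder} ^ 'n::{finite,linorder}"
  assumes "n \<ge> 2" and "CARD('n) = n"
    and "J = jordan_block 0"
    and "L = cotangent_bracket (semidirect_bracket J)"
  shows "lie_algebra L \<and> nilpotent_of_step L n \<and>
    (\<exists>S. uncountable S \<and> (\<forall>\<omega>\<in>S. symplectic_structure L \<omega>) \<and>
         pairwise (\<lambda>\<omega> \<omega>'. \<not> symplectomorphic_up_to_homothety L \<omega> \<omega>') S)"
proof (intro conjI exI[of _ "weight_form ` {1<..}"])
  have L: "L = cotangent_semidirect (jordan_block 0)" and n: "CARD('n) \<ge> 2"
    using assms by simp_all
  show "lie_algebra L"
    unfolding L by (rule lie_algebra_cotangent_semidirect)
  show "nilpotent_of_step L n"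
    unfolding L assms(2)[symmetric] by (rule nilpotent_cotangent_jordan_block[OF n])
  have eq: "\<mu> = \<nu>" if "\<mu> > 1" "\<nu> > 1"
    "symplectomorphic_up_to_homothety L (weight_form \<mu>) (weight_form \<nu>)" for \<mu> \<nu>
    using that unfolding L by (rule symplectomorphic_weight_forms_eq[OF n])
  have "lie_automorphism L id"
    by (simp add: lie_automorphism_def linear_id)
  then have refl: "symplectomorphic_up_to_homothety L \<omega> \<omega>" for \<omega>
    unfolding symplectomorphic_up_to_homothety_def by (intro exI[of _ id] exI[of _ 1]) simp
  \<comment> \<open>Equal forms are symplectomorphic through the identity, so \<open>eq\<close> also
    yields injectivity and hence uncountability.\<close>
  have "inj_on (weight_form :: real \<Rightarrow> 'n cotangent \<Rightarrow> _) {1<..}"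
  proof (rule inj_onI)
    fix \<mu> \<nu> :: real
    assume "\<mu> \<in> {1<..}" "\<nu> \<in> {1<..}" "(weight_form \<mu> :: 'n cotangent \<Rightarrow> _) = weight_form \<nu>"
    then show "\<mu> = \<nu>" using eq[of \<mu> \<nu>] refl[of "weight_form \<mu>"] by simp
  qed
  moreover have "uncountable {1::real<..}"
  proof
    assume "countable {1::real<..}"
    moreover have "{1<..<2::real} \<subseteq> {1<..}" by (simp add: subset_iff)
    ultimately have "countable {1<..<2::real}" by (rule countable_subset[rotated])
    then show False using uncountable_open_interval[of 1 "2::real"] by simp
  qed
  ultimately show "uncountable (weight_form ` {1<..} :: ('n cotangent \<Rightarrow> _) set)"
    by (metis countable_image_inj_on)
  show "\<forall>\<omega>\<in>weight_form ` {1<..}. symplectic_structure L \<omega>"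
  proof clarify
    fix \<mu> :: real assume "\<mu> > 1"
    then show "symplectic_structure L (weight_form \<mu>)" unfolding L
      by (intro symplectic_derivation_form invertible_weight_matrix weight_matrix_jordan_block) simp
  qed
  show "pairwise (\<lambda>\<omega> \<omega>'. \<not> symplectomorphic_up_to_homothety L \<omega> \<omega>') (weight_form ` {1<..})"
    unfolding pairwise_def using eq by blast
qed

end
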